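(* Let $N\ge 3$ and let $A_{\mathrm{nest}},A_{\mathrm{sw}}\in\mathbb R^{N\times N}$ be the interval matrices of the nested family and of the supplemented sliding-window family, i.e. $[A_{\mathrm{nest}}]_{ij}=1$ if $j\le i$ and $0$ otherwise, and $[A_{\mathrm{sw}}]_{ij}=1$ if $j\in\{i-1,i\}$ and $0$ otherwise. Then the singular values of $A_{\mathrm{sw}}$, up to ordering, are $$2\sin\left(\frac{(2j-1)\pi}{4N+2}\right),\quad j=1,\ldots,N,$$ whereas the singular values of $A_{\mathrm{nest}}$ are $$\frac{1}{2\sin\left(\frac{(2j-1)\pi}{4N+2}\right)},\quad j=1,\ldots,N.$$ Consequently, $$\kappa_2(A_{\mathrm{nest}})=\kappa_2(A_{\mathrm{sw}})=\frac{\cos\left(\frac{\pi}{2N+1}\right)}{\sin\left(\frac{\pi}{4N+2}\right)},$$ and $\kappa_2(A_{\mathrm{nest}})=\kappa_2(A_{\mathrm{sw}})\sim \frac{4}{\pi}N$ as $N\to\infty$.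
   Context: Given a grid $x_0<\cdots<x_N$, the nested family consists of the intervals $s_i=[x_0,x_i]$, $i=1,\ldots,N$; the supplemented sliding-window family consists of $s_1=[x_0,x_1]$ and $s_i=[x_{i-2},x_i]$, $i=2,\ldots,N$. The interval matrix of a family has $(i,j)$ entry $1$ if $[x_{j-1},x_j]\subset s_i$ and $0$ otherwise; for the two families this gives the matrices $A_{\mathrm{nest}}$ (lower triangular with all ones) and $A_{\mathrm{sw}}$ (lower bidiagonal with ones) described in the statement. $\kappa_2$ is the spectral condition number $\sigma_{\max}/\sigma_{\min}$; $f(N)\sim g(N)$ means $f(N)/g(N)\to1$. *)

theory Defs
  imports
    "Jordan_Normal_Form.Char_Poly"
    "HOL-Computational_Algebra.Computational_Algebra"
    "HOL-Library.Landau_Symbols"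
    Complex_Main
begin

definition is_grid :: "nat \<Rightarrow> (nat \<Rightarrow> real) \<Rightarrow> bool" where
  "is_grid N x \<longleftrightarrow> strict_mono_on {0..N} x"

definition nested_family :: "(nat \<Rightarrow> real) \<Rightarrow> nat \<Rightarrow> real set" where
  "nested_family x i = {x 0..x i}"

definition sliding_family :: "(nat \<Rightarrow> real) \<Rightarrow> nat \<Rightarrow> real set" where
  "sliding_family x i = (if i = 1 then {x 0..x 1} else {x (i - 2)..x i})"

text \<open>
  Intervals and grid cells are numbered from 1, but matrix entries from 0: the entry at
  \<^term>\<open>(i, j)\<close> tests the cell between \<^term>\<open>x j\<close> and \<^term>\<open>x (Suc j)\<close> against the
  interval number \<^term>\<open>Suc i\<close>. Conditions that only compare the two indices are unaffected
  by this shift.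
\<close>

definition interval_matrix :: "nat \<Rightarrow> (nat \<Rightarrow> real) \<Rightarrow> (nat \<Rightarrow> real set) \<Rightarrow> real mat" where
  "interval_matrix N x s =
     mat N N (\<lambda>(i, j). if {x j..x (Suc j)} \<subseteq> s (Suc i) then 1 else 0)"

definition A_nest :: "nat \<Rightarrow> real mat" where
  "A_nest N = mat N N (\<lambda>(i, j). if j \<le> i then 1 else 0)"

definition A_sw :: "nat \<Rightarrow> real mat" where
  "A_sw N = mat N N (\<lambda>(i, j). if Suc j = i \<or> j = i then 1 else 0)"

text \<open>
  For a square matrix: the square roots of the eigenvalues of the Gram matrix, with algebraic
  multiplicity. The Gram matrix is real symmetric, so its characteristic polynomial splits over
  the reals and the multiset has as many elements as the matrix has columns.
\<close>

definition singular_values :: "real mat \<Rightarrow> real multiset" where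
  "singular_values A = image_mset sqrt (proots (char_poly (transpose_mat A * A)))"

text \<open>Only meaningful for invertible matrices of positive dimension.\<close>

definition cond2 :: "real mat \<Rightarrow> real" where
  "cond2 A = Max (set_mset (singular_values A)) / Min (set_mset (singular_values A))"

end

theory Submission
  imports Defs "HOL-Real_Asymp.Real_Asymp"
begin

text \<open>
  Both matrices are discrete versions of differentiation and integration, and their singular
  vectors are sampled trigonometric functions. Put $s_k = \sin(k\varphi)$ and
  $d_k = s_{k+1} - s_k$. Summation takes the $d_k$ back to the $s_k$ because $s_0 = 0$, and since
  the second difference of a sine is a multiple of that sine,
  $d_k - d_{k+1} = 4\sin^2(\varphi/2)\, s_{k+1}$. If moreover $d_N = 0$, these two relations close
  up on the $N$ grid cells. They then read: the nested matrix maps $(d_k)$ to $(s_{k+1})$, and its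
  transpose maps $(s_{k+1})$ to $(d_k) / (4\sin^2(\varphi/2))$. The sliding-window matrix is the
  inverse of the nested one up to conjugation by the alternating signs $(-1)^k$, so it maps
  $((-1)^k s_{k+1})$ to $((-1)^k d_k)$, and its transpose maps the latter to
  $4\sin^2(\varphi/2)$ times the former.

  The condition $d_N = 0$ holds for $\varphi = 2\theta_j$ with
  $\theta_j = (2j-1)\pi/(4N+2)$, $j = 1,\dots,N$. These angles lie in $(0, \pi/2)$, so they give
  $N$ different eigenvalues of each $N \times N$ Gram matrix, which must therefore be all of
  them, each simple (\<open>singular_values_eqI\<close>). The extreme singular values belong to $\theta_1$
  and to $\theta_N = \pi/2 - \pi/(2N+1)$, whence the cosine in the condition number.
\<close>

section \<open>Singular values from singular pairs\<close>

text \<open>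
  A polynomial of degree at most $n$ has at most $n$ roots with multiplicity, so exhibiting $n$
  distinct ones determines the multiset of roots and shows that they are all simple.
\<close>

lemma proots_eq_mset_setI:
  fixes p :: "'a :: idom poly"
  assumes "finite S" and "p \<noteq> 0" and "degree p \<le> card S"
    and roots: "\<And>x. x \<in> S \<Longrightarrow> poly p x = 0"
  shows "proots p = mset_set S"
proof -
  have "mset_set S \<subseteq># proots p"
  proof (rule mset_subset_eqI)
    fix x
    show "count (mset_set S) x \<le> count (proots p) x"
    proof (cases "x \<in> S")
      case True
      with roots \<open>p \<noteq> 0\<close> have "order x p > 0"
        by (simp add: order_root)
      with True \<open>finite S\<close> \<open>p \<noteq> 0\<close> show ?thesis
        by simp
    qed (simp add: \<open>finite S\<close>)
  qed
  moreover have "size (proots p) \<le> size (mset_set S)"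
    using size_proots_le[of p] \<open>degree p \<le> card S\<close> by simp
  ultimately show ?thesis
    by (metis mset_subset_size not_less subset_mset.nless_le)
qed

text \<open>
  A pair $Au = w$, $A^T w = \sigma^2 u$ makes $u$ an eigenvector of the Gram matrix without the Gram
  matrix having to be computed. If there are as many different positive $\sigma$ as the matrix has
  columns, nothing else can occur in its spectrum.
\<close>

lemma singular_values_eqI:
  fixes A :: "real mat" and \<sigma> :: "nat \<Rightarrow> real" and u w :: "nat \<Rightarrow> real vec"
  assumes A: "A \<in> carrier_mat n n"
    and J: "finite J" "card J = n"
    and pos: "\<And>j. j \<in> J \<Longrightarrow> \<sigma> j > 0"
    and inj: "inj_on \<sigma> J"
    and u: "\<And>j. j \<in> J \<Longrightarrow> u j \<in> carrier_vec n" "\<And>j. j \<in> J \<Longrightarrow> u j \<noteq> 0\<^sub>v n"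
    and Au: "\<And>j. j \<in> J \<Longrightarrow> A *\<^sub>v u j = w j"
    and Aw: "\<And>j. j \<in> J \<Longrightarrow> transpose_mat A *\<^sub>v w j = (\<sigma> j)\<^sup>2 \<cdot>\<^sub>v u j"
  shows "singular_values A = image_mset \<sigma> (mset_set J)"
proof -
  let ?G = "transpose_mat A * A"
  have G: "?G \<in> carrier_mat n n"
    using A by simp
  have inj2: "inj_on (\<lambda>j. (\<sigma> j)\<^sup>2) J"
    using inj pos by (intro inj_onI) (metis inj_onD less_imp_le power2_eq_imp_eq)
  have ev: "eigenvalue ?G ((\<sigma> j)\<^sup>2)" if "j \<in> J" for j
  proof -
    have "?G *\<^sub>v u j = transpose_mat A *\<^sub>v (A *\<^sub>v u j)"
      using A u that by (intro assoc_mult_mat_vec) auto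
    then have "eigenvector ?G (u j) ((\<sigma> j)\<^sup>2)"
      using Au Aw u that A by (simp add: eigenvector_def)
    then show ?thesis
      unfolding eigenvalue_def by blast
  qed
  have "proots (char_poly ?G) = mset_set ((\<lambda>j. (\<sigma> j)\<^sup>2) ` J)"
  proof (rule proots_eq_mset_setI)
    show "char_poly ?G \<noteq> 0" "degree (char_poly ?G) \<le> card ((\<lambda>j. (\<sigma> j)\<^sup>2) ` J)"
      using degree_monic_char_poly[OF G] J inj2 by (auto simp: card_image)
  qed (use ev eigenvalue_root_char_poly[OF G] J in auto)
  then have "singular_values A = image_mset sqrt (image_mset (\<lambda>j. (\<sigma> j)\<^sup>2) (mset_set J))"
    using inj2 by (simp add: singular_values_def image_mset_mset_set)
  also have "\<dots> = image_mset \<sigma> (mset_set J)"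
    using pos J by (auto simp: multiset.map_comp less_imp_le intro!: image_mset_cong)
  finally show ?thesis .
qed

lemma cond2_eqI:
  assumes sv: "singular_values A = image_mset \<sigma> (mset_set J)"
    and "finite J" "a \<in> J" "b \<in> J"
    and le: "\<And>j. j \<in> J \<Longrightarrow> \<sigma> a \<le> \<sigma> j" "\<And>j. j \<in> J \<Longrightarrow> \<sigma> j \<le> \<sigma> b"
  shows "cond2 A = \<sigma> b / \<sigma> a"
proof -
  have "Max (\<sigma> ` J) = \<sigma> b" "Min (\<sigma> ` J) = \<sigma> a"
    using assms by (auto intro!: Max_eqI Min_eqI)
  then show ?thesis
    using \<open>finite J\<close> by (simp add: cond2_def sv)
qed

section \<open>Sampled sines as singular vectors\<close>

definition sine_diff :: "real \<Rightarrow> nat \<Rightarrow> real" where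
  "sine_diff \<phi> k = sin (real (Suc k) * \<phi>) - sin (real k * \<phi>)"

lemma sine_diff_diff:
  "sine_diff \<phi> k - sine_diff \<phi> (Suc k) = (2 * sin (\<phi> / 2))\<^sup>2 * sin (real (Suc k) * \<phi>)"
proof -
  let ?x = "real (Suc k) * \<phi>"
  have "sin (real k * \<phi>) = sin (?x - \<phi>)" "sin (real (Suc (Suc k)) * \<phi>) = sin (?x + \<phi>)"
    by (simp_all add: algebra_simps)
  then have "sine_diff \<phi> k - sine_diff \<phi> (Suc k) = 2 * (1 - cos \<phi>) * sin ?x"
    by (simp add: sine_diff_def sin_add sin_diff algebra_simps del: of_nat_Suc)
  moreover have "cos \<phi> = 1 - 2 * (sin (\<phi> / 2))\<^sup>2"
    using cos_double_sin[of "\<phi> / 2"] by simp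
  ultimately show ?thesis
    by (simp add: power2_eq_square)
qed

lemma mult_mat_vec_mat_index:
  assumes "i < n"
  shows "(mat n n f *\<^sub>v vec n g) $ i = (\<Sum>k<n. f (i, k) * g k)"
  using assms by (simp add: scalar_prod_def atLeast0LessThan)

lemma transpose_mult_mat_vec_index:
  assumes "i < n"
  shows "(transpose_mat (mat n n f) *\<^sub>v vec n g) $ i = (\<Sum>k<n. f (k, i) * g k)"
  using assms by (simp add: scalar_prod_def atLeast0LessThan)

lemma A_nest_mult_sine_diff:
  "A_nest N *\<^sub>v vec N (sine_diff \<phi>) = vec N (\<lambda>i. sin (real (Suc i) * \<phi>))"
proof (rule eq_vecI)
  fix i assume "i < dim_vec (vec N (\<lambda>i. sin (real (Suc i) * \<phi>)))"
  then have i: "i < N" by simp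
  have "(A_nest N *\<^sub>v vec N (sine_diff \<phi>)) $ i
      = (\<Sum>k<N. (if k \<le> i then 1 else 0) * sine_diff \<phi> k)"
    unfolding A_nest_def mult_mat_vec_mat_index[OF i] by simp
  also have "\<dots> = (\<Sum>k<Suc i. sine_diff \<phi> k)"
    using i by (intro sum.mono_neutral_cong_right) auto
  also have "\<dots> = sin (real (Suc i) * \<phi>)"
    unfolding sine_diff_def by (subst sum_lessThan_telescope) simp
  finally show "(A_nest N *\<^sub>v vec N (sine_diff \<phi>)) $ i = vec N (\<lambda>i. sin (real (Suc i) * \<phi>)) $ i"
    using i by simp
qed (simp add: A_nest_def)

text \<open>
  By \<open>sine_diff_diff\<close> the sines are themselves differences, so their tail sums telescope; the
  boundary term at the upper end is the one that \<open>closing\<close> removes.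
\<close>

lemma A_nest_transpose_mult_sine:
  assumes closing: "sine_diff \<phi> N = 0" and nz: "sin (\<phi> / 2) \<noteq> 0"
  shows "transpose_mat (A_nest N) *\<^sub>v vec N (\<lambda>i. sin (real (Suc i) * \<phi>))
    = (1 / (2 * sin (\<phi> / 2)))\<^sup>2 \<cdot>\<^sub>v vec N (sine_diff \<phi>)" (is "?l = ?c \<cdot>\<^sub>v ?r")
proof (rule eq_vecI)
  fix i assume "i < dim_vec (?c \<cdot>\<^sub>v ?r)"
  then have i: "i < N" by simp
  have "?l $ i = (\<Sum>k<N. (if i \<le> k then 1 else 0) * sin (real (Suc k) * \<phi>))"
    unfolding A_nest_def transpose_mult_mat_vec_index[OF i] by simp
  also have "\<dots> = (\<Sum>k=i..<N. sin (real (Suc k) * \<phi>))"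
    using i by (intro sum.mono_neutral_cong_right) auto
  also have "\<dots> = (\<Sum>k=i..<N. ?c * (sine_diff \<phi> k - sine_diff \<phi> (Suc k)))"
    using nz by (simp add: sine_diff_diff power_divide del: of_nat_Suc)
  also have "\<dots> = - ?c * (\<Sum>k=i..<N. sine_diff \<phi> (Suc k) - sine_diff \<phi> k)"
    unfolding sum_distrib_left by (intro sum.cong) (simp_all add: algebra_simps)
  also have "\<dots> = ?c * sine_diff \<phi> i"
    using i closing by (simp add: sum_Suc_diff')
  finally show "?l $ i = (?c \<cdot>\<^sub>v ?r) $ i"
    using i by simp
qed (simp add: A_nest_def)

text \<open>
  The alternating signs turn the sums of neighbours formed by the sliding-window matrix into
  differences.
\<close>

lemma A_sw_mult_sine:
  "A_sw N *\<^sub>v vec N (\<lambda>i. (-1) ^ i * sin (real (Suc i) * \<phi>))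
    = vec N (\<lambda>i. (-1) ^ i * sine_diff \<phi> i)" (is "?l = ?r")
proof (rule eq_vecI)
  fix i assume "i < dim_vec ?r"
  then have i: "i < N" by simp
  let ?u = "\<lambda>k. (-1) ^ k * sin (real (Suc k) * \<phi>)"
  have "?l $ i = (\<Sum>k<N. (if Suc k = i \<or> k = i then 1 else 0) * ?u k)"
    unfolding A_sw_def mult_mat_vec_mat_index[OF i] by simp
  also have "\<dots> = (\<Sum>k\<in>{k. Suc k = i \<or> k = i}. ?u k)"
    using i by (intro sum.mono_neutral_cong_right) auto
  also have "\<dots> = (-1) ^ i * sine_diff \<phi> i"
  proof (cases i)
    case 0
    then have "{k. Suc k = i \<or> k = i} = {0}" by auto
    with 0 show ?thesis by (simp add: sine_diff_def)
  next
    case (Suc m)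
    then have "{k. Suc k = i \<or> k = i} = {m, Suc m}" by auto
    with Suc show ?thesis by (simp add: sine_diff_def algebra_simps)
  qed
  finally show "?l $ i = ?r $ i"
    using i by simp
qed (simp add: A_sw_def)

lemma A_sw_transpose_mult_sine_diff:
  assumes closing: "sine_diff \<phi> N = 0"
  shows "transpose_mat (A_sw N) *\<^sub>v vec N (\<lambda>i. (-1) ^ i * sine_diff \<phi> i)
    = (2 * sin (\<phi> / 2))\<^sup>2 \<cdot>\<^sub>v vec N (\<lambda>i. (-1) ^ i * sin (real (Suc i) * \<phi>))"
    (is "?l = ?c \<cdot>\<^sub>v ?r")
proof (rule eq_vecI)
  fix i assume "i < dim_vec (?c \<cdot>\<^sub>v ?r)"
  then have i: "i < N" by simp
  let ?w = "\<lambda>k. (-1) ^ k * sine_diff \<phi> k"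
  have "?l $ i = (\<Sum>k<N. (if Suc i = k \<or> i = k then 1 else 0) * ?w k)"
    unfolding A_sw_def transpose_mult_mat_vec_index[OF i] by simp
  \<comment> \<open>The last column has only one nonzero entry; \<open>closing\<close> supplies the missing term as 0.\<close>
  also have "\<dots> = (\<Sum>k<Suc N. (if Suc i = k \<or> i = k then 1 else 0) * ?w k)"
    using closing by simp
  also have "\<dots> = (\<Sum>k\<in>{i, Suc i}. ?w k)"
    using i by (intro sum.mono_neutral_cong_right) auto
  also have "\<dots> = (-1) ^ i * (sine_diff \<phi> i - sine_diff \<phi> (Suc i))"
    by (simp add: algebra_simps)
  also have "\<dots> = ?c * ((-1) ^ i * sin (real (Suc i) * \<phi>))"
    unfolding sine_diff_diff by simp
  finally show "?l $ i = (?c \<cdot>\<^sub>v ?r) $ i"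
    using i by simp
qed (simp add: A_sw_def)

section \<open>The admissible angles and the singular values\<close>

text \<open>
  The frequency of the $j$-th sampled sine is twice this angle; the half is what enters the
  singular values.
\<close>

definition half_angle :: "nat \<Rightarrow> nat \<Rightarrow> real" where
  "half_angle N j = (2 * real j - 1) * pi / (4 * real N + 2)"

lemma half_angle_less_iff: "half_angle N i < half_angle N j \<longleftrightarrow> i < j"
  by (simp add: half_angle_def divide_less_cancel)

lemma half_angle_bounds:
  assumes "j \<in> {1..N}"
  shows "0 < half_angle N j" and "half_angle N j < pi / 2"
proof -
  show "0 < half_angle N j"
    using assms by (simp add: half_angle_def)
  have "(2 * real j - 1) * pi < (2 * real N + 1) * pi"
    using assms by (intro mult_strict_right_mono) auto
  then show "half_angle N j < pi / 2"
    by (simp add: half_angle_def field_simps)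
qed

lemma sin_half_angle_pos:
  assumes "j \<in> {1..N}"
  shows "0 < sin (half_angle N j)"
  using half_angle_bounds[OF assms] by (intro sin_gt_zero) linarith+

lemma sin_half_angle_less_iff:
  assumes "i \<in> {1..N}" "j \<in> {1..N}"
  shows "sin (half_angle N i) < sin (half_angle N j) \<longleftrightarrow> i < j"
proof -
  have "sin (half_angle N i) < sin (half_angle N j) \<longleftrightarrow> half_angle N i < half_angle N j"
    using half_angle_bounds[OF assms(1)] half_angle_bounds[OF assms(2)]
    by (intro sin_mono_less_eq) linarith+
  then show ?thesis
    by (simp add: half_angle_less_iff)
qed

lemma sin_half_angle_le_iff:
  assumes "i \<in> {1..N}" "j \<in> {1..N}"
  shows "sin (half_angle N i) \<le> sin (half_angle N j) \<longleftrightarrow> i \<le> j"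
  using sin_half_angle_less_iff[OF assms(2,1)] by linarith

lemma inj_on_sin_half_angle: "inj_on (\<lambda>j. sin (half_angle N j)) {1..N}"
  by (rule inj_onI) (metis less_irrefl nat_neq_iff sin_half_angle_less_iff)

text \<open>
  With $\varphi = 2\theta_j$ the numbers $N\varphi$ and $(N+1)\varphi$ add up to the odd multiple
  $(2j-1)\pi$ of $\pi$, so they have the same sine.
\<close>

lemma sine_diff_half_angle_closing: "sine_diff (2 * half_angle N j) N = 0"
proof -
  define x where "x = real N * (2 * half_angle N j)"
  have "real (Suc N) * (2 * half_angle N j) + x = (4 * real N + 2) * half_angle N j"
    by (simp add: x_def algebra_simps)
  also have "\<dots> = (2 * real j - 1) * pi"
    unfolding half_angle_def by (simp add: field_simps add_eq_0_iff)
  finally have "real (Suc N) * (2 * half_angle N j) = real j * (2 * pi) - (pi + x)"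
    by (simp add: algebra_simps)
  moreover have "sin (real j * (2 * pi)) = 0" "cos (real j * (2 * pi)) = 1"
    using sin_npi[of "2 * j"] cos_npi[of "2 * j"] by (simp_all add: algebra_simps)
  ultimately have "sin (real (Suc N) * (2 * half_angle N j)) = sin x"
    by (simp add: sin_diff sin_add del: of_nat_Suc)
  then show ?thesis
    by (simp add: sine_diff_def x_def)
qed

text \<open>This is the first entry of the singular vectors up to sign, which are therefore nonzero.\<close>

lemma first_sine_sample_pos:
  assumes "j \<in> {1..N}"
  shows "0 < sin (2 * half_angle N j)"
  using half_angle_bounds[OF assms] by (intro sin_gt_zero) linarith+

lemma singular_values_A_sw:
  "singular_values (A_sw N) = image_mset (\<lambda>j. 2 * sin (half_angle N j)) (mset_set {1..N})"
proof (rule singular_values_eqI)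
  let ?u = "\<lambda>j. vec N (\<lambda>i. (-1) ^ i * sin (real (Suc i) * (2 * half_angle N j)))"
  let ?w = "\<lambda>j. vec N (\<lambda>i. (-1) ^ i * sine_diff (2 * half_angle N j) i)"
  show "inj_on (\<lambda>j. 2 * sin (half_angle N j)) {1..N}"
    by (rule inj_onI) (use inj_onD[OF inj_on_sin_half_angle] in simp)
  fix j assume j: "j \<in> {1..N}"
  show "A_sw N *\<^sub>v ?u j = ?w j"
    by (rule A_sw_mult_sine)
  show "transpose_mat (A_sw N) *\<^sub>v ?w j = (2 * sin (half_angle N j))\<^sup>2 \<cdot>\<^sub>v ?u j"
    using A_sw_transpose_mult_sine_diff[OF sine_diff_half_angle_closing, of N j] by simp
  show "?u j \<noteq> 0\<^sub>v N"
  proof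
    assume "?u j = 0\<^sub>v N"
    then have "?u j $ 0 = 0\<^sub>v N $ 0" by simp
    with first_sine_sample_pos[OF j] j show False by simp
  qed
  show "0 < 2 * sin (half_angle N j)"
    using sin_half_angle_pos[OF j] by simp
qed (simp_all add: A_sw_def)

lemma singular_values_A_nest:
  "singular_values (A_nest N) = image_mset (\<lambda>j. 1 / (2 * sin (half_angle N j))) (mset_set {1..N})"
proof (rule singular_values_eqI)
  let ?u = "\<lambda>j. vec N (sine_diff (2 * half_angle N j))"
  let ?w = "\<lambda>j. vec N (\<lambda>i. sin (real (Suc i) * (2 * half_angle N j)))"
  show "inj_on (\<lambda>j. 1 / (2 * sin (half_angle N j))) {1..N}"
    by (rule inj_onI) (use inj_onD[OF inj_on_sin_half_angle] in simp)
  fix j assume j: "j \<in> {1..N}"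
  show "A_nest N *\<^sub>v ?u j = ?w j"
    by (rule A_nest_mult_sine_diff)
  show "transpose_mat (A_nest N) *\<^sub>v ?w j = (1 / (2 * sin (half_angle N j)))\<^sup>2 \<cdot>\<^sub>v ?u j"
    using A_nest_transpose_mult_sine[OF sine_diff_half_angle_closing, of N j]
      sin_half_angle_pos[OF j] by simp
  show "?u j \<noteq> 0\<^sub>v N"
  proof
    assume "?u j = 0\<^sub>v N"
    then have "?u j $ 0 = 0\<^sub>v N $ 0" by simp
    with first_sine_sample_pos[OF j] j show False by (simp add: sine_diff_def)
  qed
  show "0 < 1 / (2 * sin (half_angle N j))"
    using sin_half_angle_pos[OF j] by simp
qed (simp_all add: A_nest_def)

section \<open>Condition numbers\<close>

lemma sin_half_angle_last:
  "sin (half_angle N N) = cos (pi / (2 * real N + 1))"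
proof -
  have "half_angle N N = pi / 2 - pi / (2 * real N + 1)"
    by (simp add: half_angle_def field_simps add_eq_0_iff)
  then show ?thesis
    by (simp add: cos_sin_eq)
qed

lemma cond2_A_sw:
  assumes "N \<ge> 1"
  shows "cond2 (A_sw N) = cos (pi / (2 * real N + 1)) / sin (pi / (4 * real N + 2))"
proof -
  have "cond2 (A_sw N) = 2 * sin (half_angle N N) / (2 * sin (half_angle N 1))"
    by (rule cond2_eqI[OF singular_values_A_sw]) (use assms in \<open>auto simp: sin_half_angle_le_iff\<close>)
  then show ?thesis
    unfolding sin_half_angle_last by (simp add: half_angle_def)
qed

lemma cond2_A_nest:
  assumes "N \<ge> 1"
  shows "cond2 (A_nest N) = cos (pi / (2 * real N + 1)) / sin (pi / (4 * real N + 2))"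
proof -
  have le: "1 / (2 * sin (half_angle N j)) \<le> 1 / (2 * sin (half_angle N i))"
    if "i \<in> {1..N}" "j \<in> {1..N}" "i \<le> j" for i j
    using that sin_half_angle_pos[of i N]
    by (intro divide_left_mono) (auto simp: sin_half_angle_le_iff sin_half_angle_pos)
  have "cond2 (A_nest N) = 1 / (2 * sin (half_angle N 1)) / (1 / (2 * sin (half_angle N N)))"
    by (rule cond2_eqI[OF singular_values_A_nest]) (use assms le in auto)
  then show ?thesis
    unfolding sin_half_angle_last by (simp add: half_angle_def)
qed

lemma condition_number_asymptotics:
  assumes "\<And>N. N \<ge> 1 \<Longrightarrow> c N = cos (pi / (2 * real N + 1)) / sin (pi / (4 * real N + 2))"
  shows "c \<sim>[sequentially] (\<lambda>N. 4 / pi * real N)"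
proof -
  have "(\<lambda>N. cos (pi / (2 * real N + 1)) / sin (pi / (4 * real N + 2)))
      \<sim>[sequentially] (\<lambda>N. 4 / pi * real N)"
    by real_asymp
  then show ?thesis
    by (rule asymp_equiv_transfer)
      (use assms in \<open>auto intro: eventually_sequentiallyI[of 1]\<close>)
qed

section \<open>The interval matrices of the two families\<close>

lemma grid_le_iff:
  assumes "is_grid N x" "i \<le> N" "j \<le> N"
  shows "x i \<le> x j \<longleftrightarrow> i \<le> j"
  using assms by (simp add: is_grid_def strict_mono_on_leD linorder_not_le strict_mono_on_less_eq)

lemma grid_cell_subset_iff:
  assumes "is_grid N x" "j < N" "a \<le> N" "b \<le> N"
  shows "{x j..x (Suc j)} \<subseteq> {x a..x b} \<longleftrightarrow> a \<le> j \<and> Suc j \<le> b"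
  using assms by (auto simp: grid_le_iff)

lemma interval_matrix_nested:
  assumes "is_grid N x"
  shows "interval_matrix N x (nested_family x) = A_nest N"
proof -
  have "{x j..x (Suc j)} \<subseteq> nested_family x (Suc i) \<longleftrightarrow> j \<le> i" if "i < N" "j < N" for i j
    using grid_cell_subset_iff[OF assms that(2), of 0 "Suc i"] that by (simp add: nested_family_def)
  then show ?thesis
    unfolding interval_matrix_def A_nest_def by (intro cong_mat) auto
qed

lemma interval_matrix_sliding:
  assumes "is_grid N x"
  shows "interval_matrix N x (sliding_family x) = A_sw N"
proof -
  have "{x j..x (Suc j)} \<subseteq> sliding_family x (Suc i) \<longleftrightarrow> Suc j = i \<or> j = i"
    if "i < N" "j < N" for i j
  proof (cases "i = 0")
    case True
    then show ?thesis
      using grid_cell_subset_iff[OF assms that(2), of 0 1] that by (auto simp: sliding_family_def)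
  next
    case False
    then show ?thesis
      using grid_cell_subset_iff[OF assms that(2), of "Suc i - 2" "Suc i"] that
      by (auto simp: sliding_family_def)
  qed
  then show ?thesis
    unfolding interval_matrix_def A_sw_def by (intro cong_mat) auto
qed

section \<open>Spectra and conditioning of the two families\<close>

theorem proposition2:
  shows "(\<forall>N\<ge>3.
            (\<forall>x. is_grid N x \<longrightarrow>
               interval_matrix N x (nested_family x) = A_nest N \<and>
               interval_matrix N x (sliding_family x) = A_sw N) \<and>
            singular_values (A_sw N) =
              image_mset (\<lambda>j. 2 * sin ((2 * real j - 1) * pi / (4 * real N + 2)))
                (mset_set {1..N}) \<and>
            singular_values (A_nest N) =
              image_mset (\<lambda>j. 1 / (2 * sin ((2 * real j - 1) * pi / (4 * real N + 2))))
                (mset_set {1..N}) \<and>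
            cond2 (A_nest N) = cond2 (A_sw N) \<and>
            cond2 (A_sw N) = cos (pi / (2 * real N + 1)) / sin (pi / (4 * real N + 2))) \<and>
         (\<lambda>N. cond2 (A_nest N)) \<sim>[sequentially] (\<lambda>N. 4 / pi * real N) \<and>
         (\<lambda>N. cond2 (A_sw N)) \<sim>[sequentially] (\<lambda>N. 4 / pi * real N)"
  using interval_matrix_nested interval_matrix_sliding
    singular_values_A_sw[unfolded half_angle_def] singular_values_A_nest[unfolded half_angle_def]
    cond2_A_nest cond2_A_sw
    condition_number_asymptotics[OF cond2_A_nest] condition_number_asymptotics[OF cond2_A_sw]
  by simp

end
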